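(* Let $R$ be a commutative ring of prime characteristic $p$, and for $I \in \mathcal{I}(R)$ let $$I^* = \bigcap\{J \in \mathcal{I}(R) : J \supseteq I \text{ and } J \text{ is tightly closed}\}.$$ The operation $*$ is the unique semiprime operation on $R$ such that, for $I\in\mathcal{I}(R)$, $I^* = I$ if and only if $I$ is tightly closed. Moreover, for all $I \in \mathcal{I}(R)$ one has $I^T \subseteq (I^* )^T = I^*$, with equalities holding if $R$ is Noetherian. In particular, $I^*$ for any $I \in \mathcal{I}(R)$ is the smallest tightly closed ideal of $R$ containing $I$, and $*$ equals the ordinary tight closure operation if $R$ is Noetherian.
   Context: Rings are unital and not assumed Noetherian. $\mathcal{I}(R)$ is the set of all ideals of $R$, ordered by inclusion, with the usual multiplication of ideals. $R^o$ is the complement in $R$ of the union of the minimal primes of $R$. For $q=p^e$, $I^{[q]}$ is the ideal generated by $\{x^q : x\in I\}$. For $I\in\mathcal{I}(R)$, $$I^T = \{x\in R : \exists c\in R^o \text{ such that } cx^q\in I^{[q]} \text{ for all } q=p^e\gg 0\}.$$ An ideal $I$ is called tightly closed if $I^T=I$. For $R$ Noetherian, the ordinary tight closure of $I$ is $I^T$. A closure operation on a poset is a self-map that is expansive, order-preserving and idempotent. A semiprime operation on $R$ is a nucleus on $\mathcal{I}(R)$, i.e. a closure operation $\star$ on $\mathcal{I}(R)$ such that $I^\star J^\star\subseteq (IJ)^\star$ for all ideals $I,J$. *)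

theory Defs
  imports "HOL-Algebra.Algebra"
begin

(* The additive order of 1.  As group.ord is 0 for elements of infinite order, this is the
   nonnegative generator of the kernel of the unique ring homomorphism from the integers. *)
definition ring_char :: "('a, 'b) ring_scheme \<Rightarrow> nat" where
  "ring_char R = group.ord (add_monoid R) \<one>\<^bsub>R\<^esub>"

definition minimal_prime :: "('a, 'b) ring_scheme \<Rightarrow> 'a set \<Rightarrow> bool" where
  "minimal_prime R P \<longleftrightarrow>
     primeideal P R \<and> (\<forall>Q. primeideal Q R \<longrightarrow> Q \<subseteq> P \<longrightarrow> Q = P)"

definition ring_circ :: "('a, 'b) ring_scheme \<Rightarrow> 'a set" where
  "ring_circ R = carrier R - \<Union>{P. minimal_prime R P}"

definition frobenius_power :: "('a, 'b) ring_scheme \<Rightarrow> nat \<Rightarrow> 'a set \<Rightarrow> 'a set" where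
  "frobenius_power R q I = genideal R {x [^]\<^bsub>R\<^esub> q | x. x \<in> I}"

(* Intended for rings of prime characteristic p = ring_char R; "for all q = p^e >> 0" is read
   as "for all sufficiently large e". *)
definition tight_cl :: "('a, 'b) ring_scheme \<Rightarrow> 'a set \<Rightarrow> 'a set" where
  "tight_cl R I =
     {x \<in> carrier R. \<exists>c \<in> ring_circ R. \<forall>\<^sub>F e in sequentially.
        c \<otimes>\<^bsub>R\<^esub> x [^]\<^bsub>R\<^esub> (ring_char R ^ e) \<in> frobenius_power R (ring_char R ^ e) I}"

definition tightly_closed :: "('a, 'b) ring_scheme \<Rightarrow> 'a set \<Rightarrow> bool" where
  "tightly_closed R I \<longleftrightarrow> ideal I R \<and> tight_cl R I = I"

definition tight_star :: "('a, 'b) ring_scheme \<Rightarrow> 'a set \<Rightarrow> 'a set" where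
  "tight_star R I = \<Inter>{J. ideal J R \<and> I \<subseteq> J \<and> tightly_closed R J}"

definition ideal_poset :: "('a, 'b) ring_scheme \<Rightarrow> 'a set gorder" where
  "ideal_poset R = \<lparr>carrier = {I. ideal I R}, eq = (=), le = (\<subseteq>)\<rparr>"

(* Maps on a poset are HOL functions constrained only on its carrier; the definition does not
   depend on their values elsewhere. *)
definition closure_operation :: "('a, 'b) gorder_scheme \<Rightarrow> ('a \<Rightarrow> 'a) \<Rightarrow> bool" where
  "closure_operation L f \<longleftrightarrow>
     partial_order L \<and> f \<in> carrier L \<rightarrow> carrier L \<and>
     (\<forall>x \<in> carrier L. x \<sqsubseteq>\<^bsub>L\<^esub> f x) \<and> isotone L L f \<and> idempotent L f"

definition semiprime_operation :: "('a, 'b) ring_scheme \<Rightarrow> ('a set \<Rightarrow> 'a set) \<Rightarrow> bool" where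
  "semiprime_operation R f \<longleftrightarrow>
     closure_operation (ideal_poset R) f \<and>
     (\<forall>I J. ideal I R \<longrightarrow> ideal J R \<longrightarrow> f I \<cdot>\<^bsub>R\<^esub> f J \<subseteq> f (I \<cdot>\<^bsub>R\<^esub> J))"

end

theory Submission
  imports Defs
begin

text \<open>
  Tight closedness is inherited by arbitrary intersections, so \<open>*\<close> is the closure operation
  determined by the family of tightly closed ideals. It is also inherited by colon ideals
  \<open>(K : a)\<close>, because \<open>a\<^sup>q (K : a)\<^bsup>[q]\<^esup> \<subseteq> K\<^bsup>[q]\<^esup>\<close>; applying this to \<open>K = (I J)\<^sup>*\<close>, first with
  \<open>a \<in> J\<close> and then with \<open>a \<in> I\<^sup>*\<close>, gives \<open>I\<^sup>* J\<^sup>* \<subseteq> (I J)\<^sup>*\<close>. A closure operation is determined by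
  its closed elements, whence uniqueness. If \<open>R\<close> is Noetherian, the ideal \<open>I\<^sup>T\<close> is finitely
  generated, so one multiplier \<open>c\<close> satisfies \<open>c (I\<^sup>T)\<^bsup>[q]\<^esup> \<subseteq> I\<^bsup>[q]\<^esup>\<close> for all large \<open>q\<close>, and
  therefore \<open>I\<^sup>T\<close> is already tightly closed.
\<close>

section \<open>The Frobenius endomorphism\<close>

text \<open>Induction on the exponent: multiply the expansion for \<open>n\<close> by
  \<open>x\<close> and by \<open>y\<close>, then combine the coefficients by Pascal's rule.
  Coefficients are natural multiples, so that divisibility by the characteristic can be exploited
  below.\<close>

lemma (in cring) binomial_theorem:
  assumes x: "x \<in> carrier R" and y: "y \<in> carrier R"
  shows "(x \<oplus> y) [^] (n::nat) =
    (\<Oplus>k\<in>{..n}. add_pow R (n choose k) (x [^] k \<otimes> y [^] (n - k)))"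
proof (induction n)
  case 0
  show ?case by simp
next
  case (Suc n)
  define b where "b m k = x [^] k \<otimes> y [^] (m - k)" for m k :: nat
  have b[simp]: "b m k \<in> carrier R" for m k
    by (simp add: b_def x y)
  have xb: "x \<otimes> b n k = b (Suc n) (Suc k)" for k
    using x y by (simp add: b_def m_ac)
  \<comment> \<open>The bound on \<open>k\<close> matters: at \<open>k = Suc n\<close> both
    truncated differences are 0 and the factor \<open>y\<close> would be lost.\<close>
  have yb: "y \<otimes> b n k = b (Suc n) k" if "k \<le> n" for k
    using x y that by (simp add: b_def m_ac Suc_diff_le)
  define S where "S = (\<Oplus>k\<in>{..n}. add_pow R (n choose k) (b n k))"
  have S: "S \<in> carrier R"
    unfolding S_def by (rule finsum_closed) auto
  have xS: "x \<otimes> S = (\<Oplus>k\<in>{..n}. add_pow R (n choose k) (b (Suc n) (Suc k)))"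
    unfolding S_def using x by (simp add: finsum_rdistr Pi_def add_pow_rdistr xb)
  have "y \<otimes> S = (\<Oplus>k\<in>{..n}. add_pow R (n choose k) (b (Suc n) k))"
    unfolding S_def using y
    by (subst finsum_rdistr) (auto simp: Pi_def add_pow_rdistr yb intro!: add.finprod_cong')
  \<comment> \<open>The added top term has coefficient \<open>n choose Suc n = 0\<close>. Splitting
    off index 0 next aligns this sum with \<open>xS\<close>, ready for Pascal's rule.\<close>
  also have "\<dots> = (\<Oplus>k\<in>{..Suc n}. add_pow R (n choose k) (b (Suc n) k))"
    by (subst finsum_Suc) (auto intro!: l_zero[symmetric] finsum_closed simp: binomial_eq_0)
  also have "\<dots> = (\<Oplus>k\<in>{..n}. add_pow R (n choose Suc k) (b (Suc n) (Suc k))) \<oplus> b (Suc n) 0"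
    by (subst finsum_Suc2) auto
  finally have yS: "y \<otimes> S =
    (\<Oplus>k\<in>{..n}. add_pow R (n choose Suc k) (b (Suc n) (Suc k))) \<oplus> b (Suc n) 0" .
  have "(x \<oplus> y) [^] Suc n = x \<otimes> S \<oplus> y \<otimes> S"
    using x y S Suc.IH by (simp add: S_def[symmetric] b_def[symmetric] r_distr m_comm)
  also have "\<dots> = (\<Oplus>k\<in>{..n}. add_pow R (Suc n choose Suc k) (b (Suc n) (Suc k))) \<oplus> b (Suc n) 0"
    unfolding xS yS
    by (simp add: a_assoc[symmetric] finsum_addf[symmetric] Pi_def add.nat_pow_mult)
  also have "\<dots> = (\<Oplus>k\<in>{..Suc n}. add_pow R (Suc n choose k) (b (Suc n) k))"
    by (subst finsum_Suc2) auto
  finally show ?case by (simp add: b_def)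
qed

lemma (in ring) ring_char_add_pow:
  assumes a: "a \<in> carrier R"
  shows "add_pow R (ring_char R) a = \<zero>"
proof -
  have "add_pow R (ring_char R) \<one> = \<zero>"
    unfolding ring_char_def using add.pow_ord_eq_1[of \<one>] by simp
  then show ?thesis
    using add_pow_ldistr[of \<one> a "ring_char R"] a by simp
qed

text \<open>A prime p divides p choose k for 0 < k < p, so only the two outer terms of the binomial
  expansion survive.\<close>

lemma (in cring) pow_ring_char_add:
  assumes p: "Factorial_Ring.prime (ring_char R)"
    and x: "x \<in> carrier R" and y: "y \<in> carrier R"
  shows "(x \<oplus> y) [^] (ring_char R) = x [^] (ring_char R) \<oplus> y [^] (ring_char R)"
proof -
  \<comment> \<open>With p = m + 2, splitting off both ends of the sum leaves the inner indices as
    \<open>Suc k\<close> for \<open>k \<le> m\<close>.\<close>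
  obtain m where m: "ring_char R = Suc (Suc m)"
    using le_Suc_ex[OF prime_ge_2_nat[OF p]] by auto
  define t where
    "t k = add_pow R (ring_char R choose k) (x [^] k \<otimes> y [^] (ring_char R - k))" for k :: nat
  have t[simp]: "t k \<in> carrier R" for k
    by (simp add: t_def x y)
  have middle: "t (Suc k) = \<zero>" if k: "k \<le> m" for k
  proof -
    have "ring_char R dvd (ring_char R choose Suc k)"
      by (rule dvd_choose_prime) (use p k m in auto)
    then obtain j where j: "ring_char R choose Suc k = ring_char R * j" ..
    have "add_pow R (ring_char R * j) a = \<zero>" if "a \<in> carrier R" for a
      using that by (simp add: add.nat_pow_pow[symmetric] ring_char_add_pow)
    then show ?thesis
      by (simp add: t_def j x y)
  qed
  have "(x \<oplus> y) [^] (ring_char R) = (\<Oplus>k\<in>{..Suc (Suc m)}. t k)"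
    using binomial_theorem[OF x y, of "ring_char R"] by (simp add: t_def m[symmetric])
  also have "\<dots> = t (Suc (Suc m)) \<oplus> ((\<Oplus>k\<in>{..m}. t (Suc k)) \<oplus> t 0)"
    by (subst finsum_Suc, simp, subst finsum_Suc2) simp_all
  also have "(\<Oplus>k\<in>{..m}. t (Suc k)) = \<zero>"
    by (rule add.finprod_one_eqI) (simp add: middle)
  also have "t (Suc (Suc m)) = x [^] (ring_char R)"
    by (simp add: t_def m[symmetric] x)
  also have "t 0 = y [^] (ring_char R)"
    by (simp add: t_def y)
  finally show ?thesis
    using x y by simp
qed

lemma (in cring) pow_ring_char_power_add:
  assumes p: "Factorial_Ring.prime (ring_char R)"
    and x: "x \<in> carrier R" and y: "y \<in> carrier R"
  shows "(x \<oplus> y) [^] (ring_char R ^ e) = x [^] (ring_char R ^ e) \<oplus> y [^] (ring_char R ^ e)"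
proof (induction e)
  case 0
  show ?case using x y by simp
next
  case (Suc e)
  have pow: "z [^] (ring_char R ^ Suc e) = (z [^] (ring_char R ^ e)) [^] ring_char R"
    if "z \<in> carrier R" for z
    using that by (simp add: nat_pow_pow mult.commute)
  show ?case
    using x y by (simp only: pow Suc.IH pow_ring_char_add[OF p] a_closed nat_pow_closed)
qed

section \<open>Ideals and Frobenius powers\<close>

text \<open>Closure under negation comes from multiplication by -1.\<close>

lemma (in ring) ideal_if_closed:
  assumes "S \<subseteq> carrier R" "\<zero> \<in> S"
    and add: "\<And>x y. x \<in> S \<Longrightarrow> y \<in> S \<Longrightarrow> x \<oplus> y \<in> S"
    and l: "\<And>r x. r \<in> carrier R \<Longrightarrow> x \<in> S \<Longrightarrow> r \<otimes> x \<in> S"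
    and r: "\<And>r x. r \<in> carrier R \<Longrightarrow> x \<in> S \<Longrightarrow> x \<otimes> r \<in> S"
  shows "ideal S R"
proof (rule idealI[OF ring_axioms])
  have "\<ominus> x \<in> S" if "x \<in> S" for x
    using l[of "\<ominus> \<one>" x] that assms(1) by (auto simp: l_minus)
  then show "subgroup S (add_monoid R)"
    using assms by (intro add.subgroupI) (auto simp: a_inv_def)
qed (use l r in auto)

lemma (in cring) pow_generators_subset:
  "ideal I R \<Longrightarrow> {x [^] (q::nat) | x. x \<in> I} \<subseteq> carrier R"
  by (auto intro: ideal.Icarr)

lemma (in cring) frobenius_power_ideal:
  "ideal I R \<Longrightarrow> ideal (frobenius_power R q I) R"
  unfolding frobenius_power_def by (intro genideal_ideal pow_generators_subset)

lemma (in cring) pow_in_frobenius_power: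
  assumes "ideal I R" "x \<in> I"
  shows "x [^] q \<in> frobenius_power R q I"
  unfolding frobenius_power_def
  using genideal_self[OF pow_generators_subset[OF assms(1)]] assms(2) by blast

lemma (in cring) frobenius_power_mono:
  assumes "ideal I R" "ideal J R" "I \<subseteq> J"
  shows "frobenius_power R q I \<subseteq> frobenius_power R q J"
  unfolding frobenius_power_def[of R q I]
  using assms by (intro genideal_minimal frobenius_power_ideal) (auto intro: pow_in_frobenius_power)

lemma (in cring) ideal_colon:
  "ideal K R \<Longrightarrow> a \<in> carrier R \<Longrightarrow> ideal {x \<in> carrier R. a \<otimes> x \<in> K} R"
  by (rule ideal.helper_max_prime[OF _ is_cring])

text \<open>The elements that \<open>a [^] q\<close> multiplies into
  \<open>frobenius_power R q K\<close> form an ideal, so generators suffice; for them, a^q x^q =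
  (ax)^q with ax in \<open>K\<close>.\<close>

lemma (in cring) frobenius_power_colon:
  assumes K: "ideal K R" and a: "a \<in> carrier R"
    and y: "y \<in> frobenius_power R q {x \<in> carrier R. a \<otimes> x \<in> K}"
  shows "a [^] q \<otimes> y \<in> frobenius_power R q K"
proof -
  have "frobenius_power R q {x \<in> carrier R. a \<otimes> x \<in> K}
      \<subseteq> {y \<in> carrier R. a [^] q \<otimes> y \<in> frobenius_power R q K}"
    unfolding frobenius_power_def[of R q "{x \<in> carrier R. a \<otimes> x \<in> K}"]
    using K a
    by (intro genideal_minimal ideal_colon frobenius_power_ideal)
       (auto simp: nat_pow_distrib[symmetric] intro: pow_in_frobenius_power)
  with y show ?thesis by blast
qed

text \<open>Additivity of x -> x^q makes the condition linear enough to define an ideal. For fixed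
  \<open>c\<close> and \<open>e\<close> it can therefore be tested on generators, which the
  Noetherian case relies on.\<close>

lemma (in cring) ideal_frobenius_transporter:
  assumes p: "Factorial_Ring.prime (ring_char R)" and I: "ideal I R" and c: "c \<in> carrier R"
  shows "ideal {x \<in> carrier R.
    c \<otimes> x [^] (ring_char R ^ e) \<in> frobenius_power R (ring_char R ^ e) I} R"
proof -
  interpret F: ideal "frobenius_power R (ring_char R ^ e) I" R
    by (rule frobenius_power_ideal[OF I])
  \<comment> \<open>A positive exponent is what makes the power of zero equal to zero.\<close>
  have "ring_char R ^ e \<noteq> 0"
    using prime_gt_0_nat[OF p] by simp
  moreover have "c \<otimes> (r \<otimes> x) [^] (ring_char R ^ e) \<in> frobenius_power R (ring_char R ^ e) I"
    if "r \<in> carrier R" "x \<in> carrier R"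
      "c \<otimes> x [^] (ring_char R ^ e) \<in> frobenius_power R (ring_char R ^ e) I" for r x
    using F.I_l_closed[OF that(3), of "r [^] (ring_char R ^ e)"] that(1,2) c
    by (simp add: nat_pow_distrib m_lcomm)
  ultimately show ?thesis
    using c p by (intro ideal_if_closed)
      (auto simp: nat_pow_zero pow_ring_char_power_add r_distr m_comm)
qed

section \<open>Tight closure\<close>

lemma (in cring) ring_circ_closed: "c \<in> ring_circ R \<Longrightarrow> c \<in> carrier R"
  by (simp add: ring_circ_def)

lemma (in cring) one_in_ring_circ: "\<one> \<in> ring_circ R"
proof -
  have "\<one> \<notin> P" if "primeideal P R" for P
    using that primeideal.I_notcarr[OF that] primeideal.axioms(1)[OF that]
    by (metis ideal.one_imp_carrier)
  then show ?thesis
    by (auto simp: ring_circ_def minimal_prime_def)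
qed

text \<open>The complement of a union of primes is multiplicatively closed. This allows two
  multipliers to be replaced by their product.\<close>

lemma (in cring) mult_in_ring_circ:
  "c \<in> ring_circ R \<Longrightarrow> d \<in> ring_circ R \<Longrightarrow> c \<otimes> d \<in> ring_circ R"
  by (auto simp: ring_circ_def minimal_prime_def dest: primeideal.I_prime)

lemma (in cring) tight_cl_mono:
  assumes "ideal I R" "ideal J R" "I \<subseteq> J"
  shows "tight_cl R I \<subseteq> tight_cl R J"
  unfolding tight_cl_def using frobenius_power_mono[OF assms]
  by (auto elim!: bexI[rotated] eventually_mono)

lemma (in cring) tight_cl_expansive:
  assumes I: "ideal I R"
  shows "I \<subseteq> tight_cl R I"
proof
  fix x assume x: "x \<in> I"
  then have "x \<in> carrier R"
    using I by (rule ideal.Icarr[rotated])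
  with pow_in_frobenius_power[OF I x] show "x \<in> tight_cl R I"
    by (auto simp: tight_cl_def intro!: bexI[OF _ one_in_ring_circ])
qed

lemma (in cring) tightly_closedI:
  assumes "ideal I R" "tight_cl R I \<subseteq> I"
  shows "tightly_closed R I"
  using assms tight_cl_expansive unfolding tightly_closed_def by blast

section \<open>Tight closedness of intersections and colon ideals\<close>

lemma (in cring) tightly_closed_carrier: "tightly_closed R (carrier R)"
  by (rule tightly_closedI[OF oneideal]) (simp add: tight_cl_def)

text \<open>By monotonicity, the tight closure of the intersection lies in that of each member,
  which is the member itself. Nonemptiness matters because \<open>\<Inter>{}\<close> is the whole
  type rather than the carrier.\<close>

lemma (in cring) tightly_closed_Inter:
  assumes S: "\<And>J. J \<in> S \<Longrightarrow> tightly_closed R J" and "S \<noteq> {}"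
  shows "tightly_closed R (\<Inter>S)"
proof (rule tightly_closedI)
  show I: "ideal (\<Inter>S) R"
    using assms by (intro i_Intersect) (auto simp: tightly_closed_def)
  have "tight_cl R (\<Inter>S) \<subseteq> J" if "J \<in> S" for J
    using tight_cl_mono[OF I, of J] S[OF that] that by (auto simp: tightly_closed_def)
  then show "tight_cl R (\<Inter>S) \<subseteq> \<Inter>S"
    by blast
qed

lemma (in cring) tightly_closed_colon:
  assumes K: "tightly_closed R K" and a: "a \<in> carrier R"
  shows "tightly_closed R {x \<in> carrier R. a \<otimes> x \<in> K}"
proof (rule tightly_closedI)
  have K': "ideal K R" "tight_cl R K = K"
    using K by (auto simp: tightly_closed_def)
  show "ideal {x \<in> carrier R. a \<otimes> x \<in> K} R"
    by (rule ideal_colon[OF K'(1) a])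
  show "tight_cl R {x \<in> carrier R. a \<otimes> x \<in> K} \<subseteq> {x \<in> carrier R. a \<otimes> x \<in> K}"
  proof
    fix x assume "x \<in> tight_cl R {x \<in> carrier R. a \<otimes> x \<in> K}"
    then obtain c where x: "x \<in> carrier R" and c: "c \<in> ring_circ R"
      and ev: "\<forall>\<^sub>F e in sequentially. c \<otimes> x [^] (ring_char R ^ e)
        \<in> frobenius_power R (ring_char R ^ e) {x \<in> carrier R. a \<otimes> x \<in> K}"
      by (auto simp: tight_cl_def)
    \<comment> \<open>The multiplier \<open>c\<close> of \<open>x\<close> for the colon ideal thus
      also serves \<open>a \<otimes> x\<close> for \<open>K\<close>.\<close>
    have "c \<otimes> (a \<otimes> x) [^] q = a [^] q \<otimes> (c \<otimes> x [^] q)" for q :: nat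
      using x a ring_circ_closed[OF c] by (simp add: nat_pow_distrib m_lcomm)
    with ev have "\<forall>\<^sub>F e in sequentially. c \<otimes> (a \<otimes> x) [^] (ring_char R ^ e)
        \<in> frobenius_power R (ring_char R ^ e) K"
      by (auto elim!: eventually_mono intro: frobenius_power_colon[OF K'(1) a])
    with a x c have "a \<otimes> x \<in> tight_cl R K"
      by (auto simp: tight_cl_def)
    with x K'(2) show "x \<in> {x \<in> carrier R. a \<otimes> x \<in> K}" by simp
  qed
qed

section \<open>Tight closure as an ideal, and its idempotence over Noetherian rings\<close>

lemma (in cring) tight_cl_ideal:
  assumes p: "Factorial_Ring.prime (ring_char R)" and I: "ideal I R"
  shows "ideal (tight_cl R I) R"
proof (rule ideal_if_closed)
  \<comment> \<open>The tight closure consists of the elements that, for some \<open>c\<close>, lie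
    in \<open>?M c e\<close> for all large \<open>e\<close>; each \<open>?M c e\<close> is an
    ideal.\<close>
  let ?M = "\<lambda>c e. {x \<in> carrier R.
    c \<otimes> x [^] (ring_char R ^ e) \<in> frobenius_power R (ring_char R ^ e) I}"
  have mem: "x \<in> tight_cl R I \<longleftrightarrow>
      x \<in> carrier R \<and> (\<exists>c\<in>ring_circ R. \<forall>\<^sub>F e in sequentially. x \<in> ?M c e)" for x
    by (auto simp: tight_cl_def)
  have M: "ideal (?M c e) R" if "c \<in> ring_circ R" for c e
    using that by (intro ideal_frobenius_transporter[OF p I] ring_circ_closed)
  \<comment> \<open>Enlarging the multiplier only enlarges the ideal, so summands with different
    multipliers \<open>c\<close> and \<open>d\<close> meet in
    \<open>?M (c \<otimes> d) e\<close>.\<close>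
  have mult: "x \<in> ?M (c \<otimes> d) e"
    if "x \<in> ?M c e" "c \<in> ring_circ R" "d \<in> ring_circ R" for x c d e
    using that ideal.I_r_closed[OF frobenius_power_ideal[OF I], of "c \<otimes> x [^] (ring_char R ^ e)" _ d]
    by (auto simp: ring_circ_closed m_ac)
  show "tight_cl R I \<subseteq> carrier R"
    by (auto simp: tight_cl_def)
  show "\<zero> \<in> tight_cl R I"
    using tight_cl_expansive[OF I] additive_subgroup.zero_closed[OF ideal.axioms(1)[OF I]] by blast
  show "x \<oplus> y \<in> tight_cl R I" if xy: "x \<in> tight_cl R I" "y \<in> tight_cl R I" for x y
  proof -
    obtain c d where c: "c \<in> ring_circ R" and d: "d \<in> ring_circ R"
      and ev: "\<forall>\<^sub>F e in sequentially. x \<in> ?M c e" "\<forall>\<^sub>F e in sequentially. y \<in> ?M d e"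
      using xy unfolding mem by blast
    from ev have "\<forall>\<^sub>F e in sequentially. x \<oplus> y \<in> ?M (c \<otimes> d) e"
    proof eventually_elim
      case (elim e)
      have "y \<in> ?M (c \<otimes> d) e"
        using mult[OF elim(2) d c] c d by (simp add: m_comm ring_circ_closed)
      with mult[OF elim(1) c d] show ?case
        by (intro additive_subgroup.a_closed[OF ideal.axioms(1)[OF M[OF mult_in_ring_circ[OF c d]]]])
    qed
    moreover have "x \<oplus> y \<in> carrier R"
      using xy by (simp add: mem)
    ultimately show ?thesis
      using mult_in_ring_circ[OF c d] unfolding mem by blast
  qed
  show l: "r \<otimes> x \<in> tight_cl R I" if r: "r \<in> carrier R" and x: "x \<in> tight_cl R I" for r x
  proof -
    obtain c where c: "c \<in> ring_circ R" and ev: "\<forall>\<^sub>F e in sequentially. x \<in> ?M c e"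
      using x unfolding mem by blast
    from ev have "\<forall>\<^sub>F e in sequentially. r \<otimes> x \<in> ?M c e"
      by eventually_elim (rule ideal.I_l_closed[OF M[OF c] _ r])
    moreover have "r \<otimes> x \<in> carrier R"
      using x r by (simp add: mem)
    ultimately show ?thesis
      using c unfolding mem by blast
  qed
  show "x \<otimes> r \<in> tight_cl R I" if "r \<in> carrier R" "x \<in> tight_cl R I" for r x
    using l[OF that] that by (simp add: mem m_comm)
qed

text \<open>Both the multiplier and the bound on \<open>e\<close> depend on the element. For
  finitely many elements, the product of the multipliers and the largest bound work
  uniformly.\<close>

lemma (in cring) tight_cl_common_multiplier:
  assumes I: "ideal I R" and "finite A" and "A \<subseteq> tight_cl R I"
  shows "\<exists>c\<in>ring_circ R. \<forall>\<^sub>F e in sequentially. \<forall>x\<in>A.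
    c \<otimes> x [^] (ring_char R ^ e) \<in> frobenius_power R (ring_char R ^ e) I"
  using assms(2,3)
proof (induction A rule: finite_induct)
  case empty
  show ?case using one_in_ring_circ by auto
next
  case (insert a A)
  then obtain c where c: "c \<in> ring_circ R"
    and evc: "\<forall>\<^sub>F e in sequentially. \<forall>x\<in>A.
      c \<otimes> x [^] (ring_char R ^ e) \<in> frobenius_power R (ring_char R ^ e) I"
    by auto
  obtain d where d: "d \<in> ring_circ R"
    and evd: "\<forall>\<^sub>F e in sequentially.
      d \<otimes> a [^] (ring_char R ^ e) \<in> frobenius_power R (ring_char R ^ e) I"
    using insert.prems by (auto simp: tight_cl_def)
  have carr: "insert a A \<subseteq> carrier R"
    using insert.prems by (auto simp: tight_cl_def)
  note cd = ring_circ_closed[OF c] ring_circ_closed[OF d]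
  from evc evd have "\<forall>\<^sub>F e in sequentially. \<forall>x\<in>insert a A.
      (c \<otimes> d) \<otimes> x [^] (ring_char R ^ e) \<in> frobenius_power R (ring_char R ^ e) I"
  proof eventually_elim
    case (elim e)
    interpret F: ideal "frobenius_power R (ring_char R ^ e) I" R
      by (rule frobenius_power_ideal[OF I])
    show ?case
    proof
      fix x assume x: "x \<in> insert a A"
      then have xc: "x \<in> carrier R" using carr by blast
      show "(c \<otimes> d) \<otimes> x [^] (ring_char R ^ e) \<in> frobenius_power R (ring_char R ^ e) I"
      proof (cases "x = a")
        case True
        then show ?thesis
          using F.I_l_closed[OF elim(2) cd(1)] cd xc by (simp add: m_assoc)
      next
        case False
        with x elim(1) have "d \<otimes> (c \<otimes> x [^] (ring_char R ^ e))
            \<in> frobenius_power R (ring_char R ^ e) I"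
          using F.I_l_closed cd(2) by blast
        then show ?thesis
          using cd xc by (simp add: m_ac)
      qed
    qed
  qed
  with mult_in_ring_circ[OF c d] show ?case by blast
qed

lemma (in cring) tightly_closed_tight_cl:
  assumes p: "Factorial_Ring.prime (ring_char R)" and N: "noetherian_ring R" and I: "ideal I R"
  shows "tightly_closed R (tight_cl R I)"
proof (rule tightly_closedI)
  let ?q = "\<lambda>e::nat. ring_char R ^ e"
  show T: "ideal (tight_cl R I) R"
    by (rule tight_cl_ideal[OF p I])
  obtain A where A: "A \<subseteq> carrier R" "finite A" "tight_cl R I = Idl A"
    using noetherian_ring.finetely_gen[OF N T] by blast
  obtain c where c: "c \<in> ring_circ R"
    and evc: "\<forall>\<^sub>F e in sequentially. \<forall>x\<in>A. c \<otimes> x [^] ?q e \<in> frobenius_power R (?q e) I"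
    using tight_cl_common_multiplier[OF I A(2)] genideal_self[OF A(1)] A(3) by blast
  note cc = ring_circ_closed[OF c]
  from evc have evT: "\<forall>\<^sub>F e in sequentially.
      \<forall>y\<in>frobenius_power R (?q e) (tight_cl R I). c \<otimes> y \<in> frobenius_power R (?q e) I"
  proof eventually_elim
    case (elim e)
    \<comment> \<open>The right-hand side is an ideal containing the generating set
      \<open>A\<close>, hence the ideal it generates.\<close>
    have "tight_cl R I \<subseteq> {x \<in> carrier R. c \<otimes> x [^] ?q e \<in> frobenius_power R (?q e) I}"
      unfolding A(3) using elim A(1)
      by (intro genideal_minimal ideal_frobenius_transporter[OF p I cc]) auto
    \<comment> \<open>The same argument one level up: a colon ideal contains the q-th powers that
      generate the Frobenius power.\<close>
    then have "frobenius_power R (?q e) (tight_cl R I)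
        \<subseteq> {y \<in> carrier R. c \<otimes> y \<in> frobenius_power R (?q e) I}"
      unfolding frobenius_power_def[of R "?q e" "tight_cl R I"]
      by (intro genideal_minimal ideal_colon frobenius_power_ideal I cc) auto
    then show ?case by blast
  qed
  show "tight_cl R (tight_cl R I) \<subseteq> tight_cl R I"
  proof
    fix x assume "x \<in> tight_cl R (tight_cl R I)"
    then obtain d where x: "x \<in> carrier R" and d: "d \<in> ring_circ R"
      and evd: "\<forall>\<^sub>F e in sequentially. d \<otimes> x [^] ?q e \<in> frobenius_power R (?q e) (tight_cl R I)"
      by (auto simp: tight_cl_def)
    \<comment> \<open>Here \<open>d\<close> brings the power of \<open>x\<close> into the Frobenius
      power of the tight closure, and \<open>c\<close> carries that into the Frobenius power of
      \<open>I\<close>.\<close>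
    from evT evd have "\<forall>\<^sub>F e in sequentially. (c \<otimes> d) \<otimes> x [^] ?q e \<in> frobenius_power R (?q e) I"
      by eventually_elim (simp add: m_assoc x cc ring_circ_closed[OF d])
    with mult_in_ring_circ[OF c d] x show "x \<in> tight_cl R I"
      unfolding tight_cl_def by blast
  qed
qed

section \<open>The smallest tightly closed ideal containing a given ideal\<close>

lemma (in cring) tight_star_tightly_closed:
  assumes I: "ideal I R"
  shows "tightly_closed R (tight_star R I)"
  unfolding tight_star_def
proof (rule tightly_closed_Inter)
  \<comment> \<open>The unit ideal belongs to the family.\<close>
  show "{J. ideal J R \<and> I \<subseteq> J \<and> tightly_closed R J} \<noteq> {}"
    using oneideal tightly_closed_carrier ideal.Icarr[OF I] by blast
qed auto

lemma (in cring) tight_star_ideal: "ideal I R \<Longrightarrow> ideal (tight_star R I) R"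
  using tight_star_tightly_closed by (simp add: tightly_closed_def)

lemma subset_tight_star: "I \<subseteq> tight_star R I"
  by (auto simp: tight_star_def)

lemma tight_star_minimal:
  "tightly_closed R J \<Longrightarrow> I \<subseteq> J \<Longrightarrow> tight_star R I \<subseteq> J"
  by (auto simp: tight_star_def tightly_closed_def)

lemma (in cring) tight_star_eq_iff:
  "ideal I R \<Longrightarrow> tight_star R I = I \<longleftrightarrow> tightly_closed R I"
  using tight_star_tightly_closed[of I] tight_star_minimal[of R I I] subset_tight_star[of I R]
  by auto

lemma (in cring) tight_star_mult:
  assumes I: "ideal I R" and J: "ideal J R"
  shows "tight_star R I \<cdot> tight_star R J \<subseteq> tight_star R (I \<cdot> J)"
proof -
  let ?K = "tight_star R (I \<cdot> J)"
  have K: "tightly_closed R ?K"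
    by (rule tight_star_tightly_closed[OF ideal_prod_is_ideal[OF I J]])
  have IJ: "i \<otimes> j \<in> ?K" if "i \<in> I" "j \<in> J" for i j
    by (rule subsetD[OF subset_tight_star ideal_prod.prod[OF that]])
  note Ic = ideal.Icarr[OF I] and Jc = ideal.Icarr[OF J]
    and SIc = ideal.Icarr[OF tight_star_ideal[OF I]]
  \<comment> \<open>For fixed \<open>j\<close> in \<open>J\<close>, the colon ideal of
    \<open>?K\<close> by \<open>j\<close> is tightly closed and contains \<open>I\<close>, hence
    \<open>tight_star R I\<close>.\<close>
  have SIJ: "i \<otimes> j \<in> ?K" if i: "i \<in> tight_star R I" and j: "j \<in> J" for i j
  proof -
    have "I \<subseteq> {x \<in> carrier R. j \<otimes> x \<in> ?K}"
      using IJ[OF _ j] Ic Jc[OF j] by (auto simp: m_comm)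
    from tight_star_minimal[OF tightly_closed_colon[OF K Jc[OF j]] this] i
    show ?thesis using Jc[OF j] by (auto simp: m_comm)
  qed
  \<comment> \<open>Now \<open>i\<close> is fixed in \<open>tight_star R I\<close>; the previous
    step puts \<open>J\<close> inside the colon ideal by \<open>i\<close>, hence also
    \<open>tight_star R J\<close>.\<close>
  have SISJ: "i \<otimes> j \<in> ?K" if i: "i \<in> tight_star R I" and j: "j \<in> tight_star R J" for i j
  proof -
    have "J \<subseteq> {x \<in> carrier R. i \<otimes> x \<in> ?K}"
      using SIJ[OF i] Jc by auto
    from tight_star_minimal[OF tightly_closed_colon[OF K SIc[OF i]] this] j
    show ?thesis by auto
  qed
  interpret K: ideal ?K R
    using K by (simp add: tightly_closed_def)
  show ?thesis
  proof
    fix s assume "s \<in> tight_star R I \<cdot> tight_star R J"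
    then show "s \<in> ?K"
      by induction (auto intro: SISJ)
  qed
qed

section \<open>Semiprime operations and uniqueness\<close>

lemma partial_order_ideal_poset: "partial_order (ideal_poset R)"
  by unfold_locales (auto simp: ideal_poset_def)

text \<open>Used in both directions: to verify the closure axioms for \<open>tight_star\<close>, and
  to extract them from an arbitrary competitor \<open>f\<close>.\<close>

lemma closure_operation_ideal_poset_iff:
  "closure_operation (ideal_poset R) f \<longleftrightarrow>
    (\<forall>I. ideal I R \<longrightarrow> ideal (f I) R \<and> I \<subseteq> f I \<and> f (f I) = f I) \<and>
    (\<forall>I J. ideal I R \<longrightarrow> ideal J R \<longrightarrow> I \<subseteq> J \<longrightarrow> f I \<subseteq> f J)"
  using partial_order_ideal_poset[of R] partial_order.axioms(1)[OF partial_order_ideal_poset[of R]]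
  by (auto simp: closure_operation_def isotone_def idempotent_def ideal_poset_def Pi_def)

lemma (in cring) semiprime_operation_tight_star: "semiprime_operation R (tight_star R)"
  unfolding semiprime_operation_def closure_operation_ideal_poset_iff
proof (intro conjI allI impI)
  fix I J assume I: "ideal I R"
  show "ideal (tight_star R I) R"
    by (rule tight_star_ideal[OF I])
  show "I \<subseteq> tight_star R I"
    by (rule subset_tight_star)
  show "tight_star R (tight_star R I) = tight_star R I"
    using tight_star_eq_iff[OF tight_star_ideal[OF I]] tight_star_tightly_closed[OF I] by simp
  assume J: "ideal J R"
  show "tight_star R I \<cdot> tight_star R J \<subseteq> tight_star R (I \<cdot> J)"
    by (rule tight_star_mult[OF I J])
  assume "I \<subseteq> J"
  then show "tight_star R I \<subseteq> tight_star R J"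
    using subset_tight_star[of J R] by (intro tight_star_minimal tight_star_tightly_closed J) auto
qed

lemma (in cring) semiprime_operation_unique:
  assumes f: "semiprime_operation R f"
    and fixed: "\<And>I. ideal I R \<Longrightarrow> f I = I \<longleftrightarrow> tightly_closed R I"
    and I: "ideal I R"
  shows "f I = tight_star R I"
proof
  have f: "\<And>I. ideal I R \<Longrightarrow> ideal (f I) R \<and> I \<subseteq> f I \<and> f (f I) = f I"
    "\<And>I J. ideal I R \<Longrightarrow> ideal J R \<Longrightarrow> I \<subseteq> J \<Longrightarrow> f I \<subseteq> f J"
    using f by (auto simp: semiprime_operation_def closure_operation_ideal_poset_iff)
  note S = tight_star_ideal[OF I]
  \<comment> \<open>A fixed ideal above \<open>I\<close> bounds \<open>f I\<close> by
    monotonicity.\<close>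
  have "f (tight_star R I) = tight_star R I"
    using fixed[OF S] tight_star_tightly_closed[OF I] by simp
  with f(2)[OF I S subset_tight_star] show "f I \<subseteq> tight_star R I" by simp
  \<comment> \<open>By idempotence \<open>f I\<close> is fixed by \<open>f\<close>, so it is a
    tightly closed ideal containing \<open>I\<close>.\<close>
  show "tight_star R I \<subseteq> f I"
    using f(1)[OF I] fixed[of "f I"] by (intro tight_star_minimal) auto
qed

text \<open>In the Noetherian case \<open>tight_cl R I\<close> itself belongs to the family being
  intersected. The other inclusion is monotonicity applied to
  \<open>I \<subseteq> tight_star R I\<close>.\<close>

lemma (in cring) tight_star_eq_tight_cl:
  assumes "Factorial_Ring.prime (ring_char R)" "noetherian_ring R" and I: "ideal I R"
  shows "tight_star R I = tight_cl R I"
proof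
  show "tight_star R I \<subseteq> tight_cl R I"
    by (intro tight_star_minimal tightly_closed_tight_cl tight_cl_expansive assms)
  show "tight_cl R I \<subseteq> tight_star R I"
    using tight_cl_mono[OF I tight_star_ideal[OF I] subset_tight_star]
      tight_star_tightly_closed[OF I] by (simp add: tightly_closed_def)
qed

theorem proposition9p4:
  fixes R :: "('a, 'b) ring_scheme"
  assumes "cring R"
    and "Factorial_Ring.prime (ring_char R)"
  shows "semiprime_operation R (tight_star R)
    \<and> (\<forall>I. ideal I R \<longrightarrow> (tight_star R I = I \<longleftrightarrow> tightly_closed R I))
    \<and> (\<forall>f. semiprime_operation R f \<and>
             (\<forall>I. ideal I R \<longrightarrow> (f I = I \<longleftrightarrow> tightly_closed R I))
           \<longrightarrow> (\<forall>I. ideal I R \<longrightarrow> f I = tight_star R I))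
    \<and> (\<forall>I. ideal I R \<longrightarrow>
           tight_cl R I \<subseteq> tight_cl R (tight_star R I) \<and>
           tight_cl R (tight_star R I) = tight_star R I \<and>
           (noetherian_ring R \<longrightarrow> tight_cl R I = tight_cl R (tight_star R I)))
    \<and> (\<forall>I. ideal I R \<longrightarrow>
           least (ideal_poset R) (tight_star R I) {J. tightly_closed R J \<and> I \<subseteq> J})
    \<and> (noetherian_ring R \<longrightarrow> (\<forall>I. ideal I R \<longrightarrow> tight_star R I = tight_cl R I))"
proof -
  interpret cring R by fact
  have cl: "tight_cl R (tight_star R I) = tight_star R I" if "ideal I R" for I
    using tight_star_tightly_closed[OF that] by (simp add: tightly_closed_def)
  show ?thesis
  proof (intro conjI allI impI)
    show "semiprime_operation R (tight_star R)"
      by (rule semiprime_operation_tight_star)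
  next
    fix f I
    assume "semiprime_operation R f \<and> (\<forall>I. ideal I R \<longrightarrow> (f I = I \<longleftrightarrow> tightly_closed R I))"
      and "ideal I R"
    then show "f I = tight_star R I"
      by (intro semiprime_operation_unique) simp_all
  next
    fix I assume I: "ideal I R"
    show "tight_star R I = I \<longleftrightarrow> tightly_closed R I"
      by (rule tight_star_eq_iff[OF I])
    show "tight_cl R I \<subseteq> tight_cl R (tight_star R I)"
      by (rule tight_cl_mono[OF I tight_star_ideal[OF I] subset_tight_star])
    show "tight_cl R (tight_star R I) = tight_star R I"
      by (rule cl[OF I])
    show "least (ideal_poset R) (tight_star R I) {J. tightly_closed R J \<and> I \<subseteq> J}"
      using tight_star_tightly_closed[OF I] subset_tight_star[of I R] tight_star_minimal[of R _ I]
      by (auto simp: least_def ideal_poset_def tightly_closed_def)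
    assume N: "noetherian_ring R"
    show "tight_star R I = tight_cl R I"
      by (rule tight_star_eq_tight_cl[OF assms(2) N I])
    with cl[OF I] show "tight_cl R I = tight_cl R (tight_star R I)"
      by metis
  qed
qed

end
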